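(* Let $N$ be a positive integer, and let $F_{N,a}:[0,1]\to[0,1]$, $a_{\min}<a<1$, be the family of self-affine functions defined in the context, with $a_{\min}=\frac{1}{N+1}$ and thresholds $a_0^*=a_0^*(N)$ and $\tilde a_0=\tilde a_0(N)$ as defined there. (i) If $a_0^*\le a<1$, then $F_{N,a}$ is nowhere differentiable. (ii) If $\tilde a_0\le a<a_0^*$, then $F_{N,a}$ is nondifferentiable almost everywhere (with respect to Lebesgue measure), but is differentiable at uncountably many points. (iii) If $a_{\min}<a<\tilde a_0$, then $F_{N,a}$ is differentiable almost everywhere, but is nondifferentiable at uncountably many points. Moreover, (for any $a_{\min}<a<1$) if $F_{N,a}$ is differentiable at a point $x\in(0,1)$, then $F_{N,a}'(x)=0$.
   Context: Construction of $F_{N,a}$. Fix a positive integer $N$ and a real $a$ with $\frac{1}{N+1}<a<1$, and let $b$ be the number with $(N+1)a-Nb=1$ (so $0<b<a$). Let $x_i:=i/(2N+1)$ for $i=0,1,\dots,2N+1$, and for $j=0,1,\dots,N$ put $y_{2j}:=j(a-b)$ and $y_{2j+1}:=(j+1)a-jb$. Set $f_0(x):=x$ on $[0,1]$ and, for $n\ge1$, define $f_n$ recursively on each interval $[x_i,x_{i+1}]$, $i=0,1,\dots,2N$, by $$f_n(x):=y_i+(y_{i+1}-y_i)\,f_{n-1}\big((2N+1)(x-x_i)\big),\qquad x_i\le x\le x_{i+1}.$$ Each $f_n$ is a continuous, piecewise linear function from $[0,1]$ onto itself, and $(f_n)$ converges uniformly to a continuous function $F_{N,a}:[0,1]\to[0,1]$.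 Thresholds. $a_{\min}:=\frac{1}{N+1}$; $a_0^*:=\frac{3N+1}{(N+1)(2N+1)}$; and $\tilde a_0$ is the unique root $a$ in $(a_{\min},1)$ of the equation $$(2N+1)^{2N+1}a^{N+1}\big((N+1)a-1\big)^N=N^N.$$ Convention. A function $f$ is called differentiable at $x$ if it has a well-defined finite derivative at $x$ (infinite derivatives do not count). *)

theory Defs
  imports "HOL-Analysis.Analysis"
begin

definition b_par :: "nat \<Rightarrow> real \<Rightarrow> real" where
  "b_par N a = ((real N + 1) * a - 1) / real N"

lemma b_par_eq: "N > 0 \<Longrightarrow> (real N + 1) * a - real N * b_par N a = 1"
  by (simp add: b_par_def)

definition xnode :: "nat \<Rightarrow> nat \<Rightarrow> real" where
  "xnode N i = real i / (2 * real N + 1)"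

definition ynode :: "nat \<Rightarrow> real \<Rightarrow> nat \<Rightarrow> real" where
  "ynode N a i =
     (let j = i div 2; b = b_par N a in
      if even i then real j * (a - b) else (real j + 1) * a - real j * b)"

text \<open>
  The number of a subinterval \<open>[xnode N i, xnode N (i + 1)]\<close>, \<open>i \<le> 2 * N\<close>, containing a given
  point of \<open>[0, 1]\<close>.  An interior node lies in two subintervals, and the right one is taken; the
  lemma \<open>fseq_rec\<close> below shows that the recursion for \<open>fseq\<close> holds on every closed
  subinterval, so that this choice is immaterial.
\<close>
definition piece :: "nat \<Rightarrow> real \<Rightarrow> nat" where
  "piece N x = min (2 * N) (nat \<lfloor>(2 * real N + 1) * x\<rfloor>)"

text \<open>Only the values on \<open>[0, 1]\<close> of \<open>fseq N a n\<close> and of \<open>F N a\<close> are meaningful.\<close>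
fun fseq :: "nat \<Rightarrow> real \<Rightarrow> nat \<Rightarrow> real \<Rightarrow> real" where
  "fseq N a 0 x = x"
| "fseq N a (Suc n) x =
     (let i = piece N x in
      ynode N a i + (ynode N a (Suc i) - ynode N a i)
        * fseq N a n ((2 * real N + 1) * (x - xnode N i)))"

definition F :: "nat \<Rightarrow> real \<Rightarrow> real \<Rightarrow> real" where
  "F N a x = lim (\<lambda>n. fseq N a n x)"

definition a_min :: "nat \<Rightarrow> real" where
  "a_min N = 1 / (real N + 1)"

definition a0_star :: "nat \<Rightarrow> real" where
  "a0_star N = (3 * real N + 1) / ((real N + 1) * (2 * real N + 1))"

definition a0_tilde :: "nat \<Rightarrow> real" where
  "a0_tilde N = (THE a. a_min N < a \<and> a < 1 \<and>
     (2 * real N + 1) ^ (2 * N + 1) * a ^ (N + 1) * ((real N + 1) * a - 1) ^ N = real N ^ N)"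


lemma a_min_pos: "0 < a_min N"
  by (simp add: a_min_def add_nonneg_pos)

lemma ynode_step:
  "ynode N a (Suc i) - ynode N a i = (if even i then a else - b_par N a)"
proof (cases "even i")
  case True
  then obtain j where "i = 2 * j" by (elim evenE)
  then show ?thesis by (simp add: ynode_def Let_def algebra_simps)
next
  case False
  then obtain j where "i = 2 * j + 1" by (elim oddE)
  then show ?thesis by (simp add: ynode_def Let_def algebra_simps)
qed

lemma rescale: "(2 * real N + 1) * (x - xnode N i) = (2 * real N + 1) * x - real i"
proof -
  have "(2 * real N + 1) * xnode N i = real i" by (simp add: xnode_def)
  then show ?thesis by (simp only: right_diff_distrib)
qed

lemma piece_0: "piece N 0 = 0"
  by (simp add: piece_def)

lemma piece_1: "piece N 1 = 2 * N"
proof -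
  have "\<lfloor>2 * real N + 1\<rfloor> = 2 * int N + 1" by linarith
  then show ?thesis by (simp add: piece_def)
qed

lemma fseq_0: "fseq N a n 0 = 0"
  by (induction n) (simp_all add: piece_0 xnode_def ynode_def Let_def)

lemma fseq_1:
  assumes "N > 0"
  shows "fseq N a n 1 = 1"
proof (induction n)
  case (Suc n)
  have "(2 * real N + 1) * (1 - xnode N (2 * N)) = 1"
    by (simp add: xnode_def field_simps)
  moreover have "ynode N a (Suc (2 * N)) = 1"
    using b_par_eq[OF assms, of a] by (simp add: ynode_def Let_def)
  ultimately show ?case
    using Suc by (simp add: piece_1 Let_def del: mult_Suc_right)
qed simp

lemma fseq_rec:
  assumes "N > 0" "i \<le> 2 * N" "xnode N i \<le> x" "x \<le> xnode N (Suc i)"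
  shows "fseq N a (Suc n) x =
    ynode N a i + (ynode N a (Suc i) - ynode N a i) * fseq N a n ((2 * real N + 1) * (x - xnode N i))"
proof -
  have l: "real i \<le> (2 * real N + 1) * x" and u: "(2 * real N + 1) * x \<le> real i + 1"
    using assms by (simp_all add: xnode_def field_simps)
  show ?thesis
  proof (cases "(2 * real N + 1) * x < real i + 1 \<or> i = 2 * N")
    case True
    have "piece N x = i"
    proof (cases "(2 * real N + 1) * x < real i + 1")
      case True
      then have "\<lfloor>(2 * real N + 1) * x\<rfloor> = int i" using l by linarith
      then show ?thesis using assms by (simp add: piece_def)
    next
      case False
      then have "\<lfloor>(2 * real N + 1) * x\<rfloor> = int i + 1" "i = 2 * N" using u True by linarith+
      then show ?thesis by (simp add: piece_def)
    qed
    then show ?thesis by (simp add: Let_def)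
  next
    case False
    then have e: "(2 * real N + 1) * x = real i + 1" and i: "i < 2 * N" using u assms by auto
    then have "\<lfloor>(2 * real N + 1) * x\<rfloor> = int i + 1" by linarith
    then have p: "piece N x = Suc i" using i by (simp add: piece_def)
    have "(2 * real N + 1) * (x - xnode N (Suc i)) = 0" "(2 * real N + 1) * (x - xnode N i) = 1"
      unfolding rescale using e by simp_all
    then show ?thesis
      unfolding fseq.simps(2) p Let_def by (simp only: fseq_0 fseq_1[OF assms(1)]) simp
  qed
qed

lemma piece_bounds:
  assumes "0 \<le> x" "x \<le> 1"
  shows "piece N x \<le> 2 * N" "xnode N (piece N x) \<le> x" "x \<le> xnode N (Suc (piece N x))"
proof -
  let ?t = "(2 * real N + 1) * x"
  have t: "0 \<le> ?t" "?t \<le> 2 * real N + 1"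
    using assms mult_left_mono[of x 1 "2 * real N + 1"] by auto
  have "real (piece N x) \<le> ?t \<and> ?t \<le> real (piece N x) + 1"
  proof (cases "nat \<lfloor>?t\<rfloor> \<le> 2 * N")
    case True
    then have "piece N x = nat \<lfloor>?t\<rfloor>" by (simp add: piece_def)
    moreover have "real (nat \<lfloor>?t\<rfloor>) = of_int \<lfloor>?t\<rfloor>" using t by simp
    ultimately show ?thesis by linarith
  next
    case False
    then have "piece N x = 2 * N" by (simp add: piece_def)
    moreover have "of_int \<lfloor>?t\<rfloor> \<ge> 2 * real N + 1" using False by linarith
    moreover have "?t \<ge> of_int \<lfloor>?t\<rfloor>" by simp
    moreover have "real (2 * N) = 2 * real N" by simp
    ultimately show ?thesis using t by linarith
  qed
  then show "xnode N (piece N x) \<le> x" "x \<le> xnode N (Suc (piece N x))"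
    by (simp_all add: xnode_def field_simps)
qed (simp add: piece_def)

lemma arg_bounds:
  assumes "xnode N i \<le> x" "x \<le> xnode N (Suc i)"
  shows "(2 * real N + 1) * (x - xnode N i) \<in> {0..1}"
proof -
  have "real i \<le> (2 * real N + 1) * x" "(2 * real N + 1) * x \<le> real i + 1"
    using assms by (simp_all add: xnode_def field_simps)
  then show ?thesis unfolding rescale by simp
qed

lemma ynode_bounds:
  assumes "N > 0" "0 \<le> a" "a \<le> 1" "i \<le> 2 * N + 1"
  shows "ynode N a i \<in> {0..1}"
proof -
  define j where "j = i div 2"
  have j: "real j \<le> real N" using assms by (simp add: j_def)
  have ab: "a - b_par N a = (1 - a) / N"
    using assms by (simp add: b_par_def field_simps)
  have "real j * (a - b_par N a) = (real j / N) * (1 - a)" using ab by simp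
  moreover have "0 \<le> (real j / N) * (1 - a)" using assms by simp
  moreover have "(real j / N) * (1 - a) \<le> 1 * (1 - a)"
    using j assms by (intro mult_right_mono) auto
  moreover have "ynode N a i = real j * (a - b_par N a) + (if even i then 0 else a)"
    by (simp add: ynode_def Let_def j_def algebra_simps)
  ultimately have "0 \<le> ynode N a i" "ynode N a i \<le> 1"
    using assms(2,3) by (simp_all split: if_splits)
  then show ?thesis by simp
qed

lemma fseq_bounds:
  assumes "N > 0" "0 \<le> a" "a \<le> 1" "x \<in> {0..1}"
  shows "fseq N a n x \<in> {0..1}"
  using assms(4)
proof (induction n arbitrary: x)
  case (Suc n)
  let ?i = "piece N x"
  note p = piece_bounds[of x N]
  define t where "t = fseq N a n ((2 * real N + 1) * (x - xnode N ?i))"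
  have t: "t \<in> {0..1}" unfolding t_def using Suc p by (intro Suc.IH arg_bounds) auto
  have y: "ynode N a ?i \<in> {0..1}" "ynode N a (Suc ?i) \<in> {0..1}"
    using assms p Suc.prems by (intro ynode_bounds; simp)+
  have "convex {0..1::real}" by simp
  then have "(1 - t) *\<^sub>R ynode N a ?i + t *\<^sub>R ynode N a (Suc ?i) \<in> {0..1}"
    using t y by (intro convexD) auto
  moreover have "fseq N a (Suc n) x = (1 - t) *\<^sub>R ynode N a ?i + t *\<^sub>R ynode N a (Suc ?i)"
    by (simp add: t_def Let_def algebra_simps)
  ultimately show ?case by simp
qed simp

lemma fseq_diff:
  assumes "N > 0" "a_min N < a" "a < 1" "x \<in> {0..1}"
  shows "\<bar>fseq N a (Suc n) x - fseq N a n x\<bar> \<le> a ^ n"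
  using assms(4)
proof (induction n arbitrary: x)
  case 0
  have "a > 0" using assms(2) a_min_pos[of N] by linarith
  then have "fseq N a (Suc 0) x \<in> {0..1}" using assms 0 by (intro fseq_bounds) auto
  then show ?case using 0 by (auto simp del: fseq.simps(2))
next
  case (Suc n)
  have a: "a > 0" using assms(2) a_min_pos[of N] by linarith
  have "(real N + 1) * a > 1" using assms by (simp add: a_min_def field_simps)
  then have b: "0 < b_par N a" "b_par N a < a"
    using assms by (simp_all add: b_par_def field_simps)
  let ?i = "piece N x"
  let ?u = "(2 * real N + 1) * (x - xnode N ?i)"
  have u: "?u \<in> {0..1}" using Suc.prems by (intro arg_bounds piece_bounds) auto
  let ?d = "ynode N a (Suc ?i) - ynode N a ?i"
  have "fseq N a (Suc (Suc n)) x - fseq N a (Suc n) x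
      = ?d * (fseq N a (Suc n) ?u - fseq N a n ?u)"
    by (subst (1 2) fseq.simps(2)) (simp add: Let_def algebra_simps del: fseq.simps)
  also have "\<bar>\<dots>\<bar> \<le> a * a ^ n"
    unfolding abs_mult
  proof (rule mult_mono)
    show "\<bar>?d\<bar> \<le> a" using a b by (auto simp: ynode_step)
  qed (use Suc.IH[OF u] a in auto)
  finally show ?case by simp
qed

text \<open>The limit defining \<open>F N a\<close> exists, and the convergence is uniform.\<close>
lemma uniform_limit_F:
  assumes "N > 0" "a_min N < a" "a < 1"
  shows "uniform_limit {0..1} (fseq N a) (F N a) sequentially"
proof -
  have a: "a > 0" using assms(2) a_min_pos[of N] by linarith
  define g where "g n x = fseq N a (Suc n) x - fseq N a n x" for n x
  have "uniform_limit {0..1} (\<lambda>n x. \<Sum>i<n. g i x) (\<lambda>x. suminf (\<lambda>i. g i x)) sequentially"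
  proof (rule Weierstrass_m_test)
    show "norm (g n x) \<le> a ^ n" if "x \<in> {0..1}" for n x
      using fseq_diff[OF assms that] by (simp add: g_def del: fseq.simps)
    show "summable ((^) a)" using a assms by (simp add: summable_geometric)
  qed
  then have "uniform_limit {0..1} (\<lambda>n x. x + (\<Sum>i<n. g i x)) (\<lambda>x. x + suminf (\<lambda>i. g i x)) sequentially"
    by (intro uniform_limit_intros)
  moreover have "x + (\<Sum>i<n. g i x) = fseq N a n x" for n x
    unfolding g_def by (subst sum_lessThan_telescope) simp
  ultimately have u: "uniform_limit {0..1} (fseq N a) (\<lambda>x. x + suminf (\<lambda>i. g i x)) sequentially"
    by simp
  have "F N a x = x + suminf (\<lambda>i. g i x)" if "x \<in> {0..1}" for x
    unfolding F_def using tendsto_uniform_limitI[OF u that] by (rule limI)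
  then show ?thesis using uniform_limit_cong'[of "{0..1}" "fseq N a" "fseq N a" "F N a"] u by simp
qed

text \<open>The description of \<open>a0_tilde N\<close> determines it.\<close>
lemma a0_tilde_unique:
  assumes "N > 0"
  shows "\<exists>!a. a_min N < a \<and> a < 1 \<and>
     (2 * real N + 1) ^ (2 * N + 1) * a ^ (N + 1) * ((real N + 1) * a - 1) ^ N = real N ^ N"
proof -
  define g where "g a = (2 * real N + 1) ^ (2 * N + 1) * a ^ (N + 1) * ((real N + 1) * a - 1) ^ N"
    for a :: real
  have m: "0 < a_min N" "a_min N < 1" using assms by (simp_all add: a_min_def)
  have mono: "g s < g t" if "a_min N < s" "s < t" for s t
  proof -
    have s: "(real N + 1) * s > 1" using that(1) by (simp add: a_min_def field_simps)
    have st: "(real N + 1) * s < (real N + 1) * t" using that(2) by simp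
    have "s ^ (N + 1) < t ^ (N + 1)" using that m by (intro power_strict_mono) auto
    moreover have "((real N + 1) * s - 1) ^ N < ((real N + 1) * t - 1) ^ N"
      using s st assms by (intro power_strict_mono) auto
    ultimately have "s ^ (N + 1) * ((real N + 1) * s - 1) ^ N
        < t ^ (N + 1) * ((real N + 1) * t - 1) ^ N"
      using s m that by (intro mult_strict_mono) auto
    then show ?thesis unfolding g_def mult.assoc by (intro mult_strict_left_mono) auto
  qed
  have g0: "g (a_min N) = 0" using assms by (simp add: g_def a_min_def)
  have N: "real N ^ N > 0" using assms by simp
  have "1 ^ (2 * N + 1) < (2 * real N + 1) ^ (2 * N + 1)"
    using assms by (intro power_strict_mono) auto
  then have g1: "g 1 > real N ^ N" using N by (simp add: g_def)
  have "\<exists>x\<ge>a_min N. x \<le> 1 \<and> g x = real N ^ N"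
  proof (rule IVT')
    show "continuous_on {a_min N..1} g" unfolding g_def by (intro continuous_intros)
  qed (use g0 g1 N m in auto)
  then obtain x where x: "a_min N \<le> x" "x \<le> 1" "g x = real N ^ N" by blast
  have "x \<noteq> a_min N" "x \<noteq> 1" using x g0 g1 N by auto
  then have "a_min N < x \<and> x < 1 \<and> g x = real N ^ N" using x by auto
  then have "\<exists>!a. a_min N < a \<and> a < 1 \<and> g a = real N ^ N"
  proof (rule ex1I)
    show "y = x" if "a_min N < y \<and> y < 1 \<and> g y = real N ^ N" for y
      using mono[of x y] mono[of y x] that \<open>a_min N < x \<and> x < 1 \<and> g x = real N ^ N\<close>
      by (cases x y rule: linorder_cases) auto
  qed
  then show ?thesis unfolding g_def .
qed

end

theory Submission
  imports Defs
begin

text \<open>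
  Put \<open>M = 2 * N + 1\<close>. The graph of \<open>F N a\<close> over a cell \<open>[k / M ^ n, (k + 1) / M ^ n]\<close> is an affine
  copy of the whole graph, and the modulus of the slope of its chord is the product, over the
  base-\<open>M\<close> digits of \<open>k\<close>, of a factor \<open>M * a > 1\<close> for an even digit and \<open>M * b\<close> for an odd one.
  Everything rests on one criterion: \<open>F N a\<close> is differentiable at a point exactly
  when these products tend to 0 along the cells around the point, and the derivative is then 0
  (\<open>F_derivative_zero\<close>, \<open>F_differentiable_imp\<close>).

  A derivative would be the limit of the signed chord slopes. Consecutive ones have the
  quotient \<open>M * a\<close> or \<open>- (M * b)\<close>, which stays away from 1, so that the limit can only be 0.
  Conversely, a point \<open>y\<close> close to \<open>x\<close> lies in the cell of \<open>x\<close> or in an adjacent one, of a size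
  comparable with \<open>\<bar>y - x\<bar>\<close>. Addresses of adjacent cells differ by a carry: one of the two ends
  in a string of digits 0 where the other one ends in a string of digits \<open>2 * N\<close>, and these
  digits have equal factors; a single pair of digits \<open>i\<close>, \<open>i + 1\<close> contributes a quotient
  \<open>a / b\<close> or \<open>b / a\<close>. Hence adjacent slopes are
  comparable (\<open>digit_prod_neighbour\<close>), and small chord slopes at \<open>x\<close> control all difference
  quotients at \<open>x\<close>.

  The theorem is now a statement about products of digit factors. For
  \<open>a0_star N \<le> a\<close>, which means \<open>M * b \<ge> 1\<close>, they never become smaller than 1. The logarithms of the factors
  are independent, identically distributed steps under Lebesgue measure, and \<open>a < a0_tilde N\<close>
  says that the mean step is negative. With a negative mean, an exponential moment
  and the Borel-Cantelli lemma give convergence to 0 almost everywhere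
  (\<open>AE_digit_prod_tendsto_zero\<close>). With a nonnegative mean, a walk that drifts to \<open>- \<infinity>\<close> would,
  stopped on exceeding a level, contradict that its expectation stays nonnegative
  (\<open>AE_not_digit_prod_tendsto_zero\<close>); this covers the boundary case of mean 0, in
  which the law of large numbers decides nothing. Uncountable sets of exceptional points come
  from digit sequences in which infinitely many digits may be chosen freely from
  \<open>{0, 2}\<close>, two even digits with the same factor (\<open>uncountable_digit_choices\<close>).
\<close>

section \<open>Expansions in an integer base\<close>

definition cell :: "nat \<Rightarrow> nat \<Rightarrow> nat \<Rightarrow> real set" where
  "cell M n k = {real k / real M ^ n .. (real k + 1) / real M ^ n}"

text \<open>
  Both base-\<open>M\<close> expansions of an interior grid point are admitted: \<open>k n\<close> is the number of some closed
  cell of level \<open>n\<close> around \<open>x\<close>, and the cells are nested. The last digit of \<open>k n\<close> is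
  the \<open>n\<close>-th digit of the expansion.
\<close>
definition expansion :: "nat \<Rightarrow> real \<Rightarrow> (nat \<Rightarrow> nat) \<Rightarrow> bool" where
  "expansion M x k \<longleftrightarrow> (\<forall>n. k n < M ^ n \<and> k (Suc n) div M = k n \<and> x \<in> cell M n (k n))"

fun digit_prod :: "nat \<Rightarrow> (nat \<Rightarrow> real) \<Rightarrow> nat \<Rightarrow> nat \<Rightarrow> real" where
  "digit_prod M w 0 k = 1"
| "digit_prod M w (Suc n) k = digit_prod M w n (k div M) * w (k mod M)"

fun address :: "nat \<Rightarrow> (nat \<Rightarrow> nat) \<Rightarrow> nat \<Rightarrow> nat" where
  "address M d 0 = 0"
| "address M d (Suc n) = M * address M d n + d n"

lemma in_cell_iff:
  assumes "0 < M"
  shows "x \<in> cell M n k \<longleftrightarrow> real k \<le> real M ^ n * x \<and> real M ^ n * x \<le> real k + 1"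
  using assms by (simp add: cell_def field_simps)

lemma digit_exists:
  assumes "0 < M" "0 \<le> t" "t \<le> real M"
  shows "\<exists>i<M. real i \<le> t \<and> t \<le> real i + 1"
proof (cases "t = real M")
  case True
  then show ?thesis using assms by (intro exI[of _ "M - 1"]) (auto simp: of_nat_diff)
next
  case False
  then have "nat \<lfloor>t\<rfloor> < M" using assms by linarith
  moreover have "real (nat \<lfloor>t\<rfloor>) \<le> t" "t \<le> real (nat \<lfloor>t\<rfloor>) + 1" using assms by linarith+
  ultimately show ?thesis by blast
qed

lemma expansion_exists:
  assumes M: "0 < M" and x: "x \<in> {0..1}"
  shows "\<exists>k. expansion M x k"
proof -
  have "\<exists>k. \<forall>n. (k n < M ^ n \<and> x \<in> cell M n (k n)) \<and> k (Suc n) div M = k n"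
  proof (rule dependent_nat_choice)
    show "\<exists>k. k < M ^ 0 \<and> x \<in> cell M 0 k" using x by (auto simp: cell_def)
  next
    fix k n assume k: "k < M ^ n \<and> x \<in> cell M n k"
    define t where "t = real M * (real M ^ n * x - real k)"
    have "0 \<le> real M ^ n * x - real k" "real M ^ n * x - real k \<le> 1"
      using k M by (auto simp: in_cell_iff)
    then have "0 \<le> t" "t \<le> real M" unfolding t_def by (auto simp: mult_left_le)
    then obtain i where i: "i < M" "real i \<le> t" "t \<le> real i + 1"
      using digit_exists[OF M] by blast
    have "M * k + i < M * Suc k" using i by simp
    also have "\<dots> \<le> M * M ^ n" using k by (intro mult_le_mono2) simp
    finally have "M * k + i < M ^ Suc n" by simp
    moreover have "x \<in> cell M (Suc n) (M * k + i)"
      using i M by (simp add: in_cell_iff t_def algebra_simps)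
    moreover have "(M * k + i) div M = k" using i M by simp
    ultimately show "\<exists>k'. (k' < M ^ Suc n \<and> x \<in> cell M (Suc n) k') \<and> k' div M = k" by blast
  qed
  then show ?thesis unfolding expansion_def by blast
qed

lemma address_expansion_exists:
  assumes M: "2 \<le> M" and d: "\<And>n. d n < M"
  shows "\<exists>x. expansion M x (address M d)"
proof -
  let ?k = "address M d"
  have M0: "0 < M" using M by simp
  have less: "?k n < M ^ n" for n
  proof (induction n)
    case (Suc n)
    have "M * ?k n + d n < M * Suc (?k n)" using d[of n] by simp
    also have "\<dots> \<le> M * M ^ n" using Suc by (intro mult_le_mono2) simp
    finally show ?case by simp
  qed simp
  let ?l = "\<lambda>n. real (?k n) / real M ^ n" and ?u = "\<lambda>n. (real (?k n) + 1) / real M ^ n"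
  have d': "real (d n) + 1 \<le> real M" for n using d[of n] by linarith
  have "(\<lambda>n. ?l n - ?u n) = (\<lambda>n. - ((1 / real M) ^ n))"
    by (auto simp: fun_eq_iff diff_divide_distrib[symmetric] power_one_over)
  moreover have "(\<lambda>n. - ((1 / real M) ^ n)) \<longlonglongrightarrow> 0"
    using M by (intro tendsto_minus_cancel_left[THEN iffD1]) (simp add: LIMSEQ_realpow_zero)
  ultimately have "(\<lambda>n. ?l n - ?u n) \<longlonglongrightarrow> 0" by simp
  moreover have "\<forall>n. ?l n \<le> ?l (Suc n)" using M0 by (simp add: field_simps)
  moreover have "?u (Suc n) \<le> ?u n" for n
  proof -
    have "(real (d n) + 1) * real M ^ n \<le> real M * real M ^ n" using d' by (intro mult_right_mono) auto
    then show ?thesis using M0 by (simp add: field_simps)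
  qed
  moreover have "\<forall>n. ?l n \<le> ?u n" using M0 by (simp add: field_simps)
  ultimately obtain x where "\<And>n. ?l n \<le> x" "\<And>n. x \<le> ?u n"
    using nested_sequence_unique[of ?l ?u] by blast
  then have "x \<in> cell M n (?k n)" for n unfolding cell_def by simp
  moreover have "?k (Suc n) div M = ?k n" for n using d[of n] M0 by simp
  ultimately show ?thesis using less unfolding expansion_def by blast
qed

lemma digit_prod_address:
  assumes "\<And>n. d n < M"
  shows "digit_prod M w n (address M d n) = (\<Prod>i<n. w (d i))"
proof (induction n)
  case (Suc n)
  have "0 < M" using assms[of n] by simp
  then show ?case using Suc assms[of n] by simp
qed simp

text \<open>
  The addresses of two expansions of the same point are at most 1 apart on every level,
  whereas the addresses separate by 2 where the digits differ for the first time.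
\<close>
lemma expansion_even_difference:
  assumes M: "0 < M"
    and x: "expansion M x (address M d)" "expansion M x (address M e)"
    and de: "\<And>n. d n = e n \<or> {d n, e n} = {0, 2}"
  shows "d = e"
proof -
  have eq: "d n = e n" if "address M d n = address M e n" for n
  proof (rule ccontr)
    assume "d n \<noteq> e n"
    then have "d n = 0 \<and> e n = 2 \<or> d n = 2 \<and> e n = 0" using de[of n] by (auto simp: doubleton_eq_iff)
    then have "real (address M d (Suc n)) + 2 = real (address M e (Suc n))
        \<or> real (address M e (Suc n)) + 2 = real (address M d (Suc n))"
      using that by auto
    moreover have "x \<in> cell M (Suc n) (address M d (Suc n))" "x \<in> cell M (Suc n) (address M e (Suc n))"
      using x unfolding expansion_def by blast+
    ultimately show False using M by (auto simp: in_cell_iff simp del: address.simps)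
  qed
  have "address M d n = address M e n" for n
    by (induction n) (auto simp: eq)
  then show ?thesis using eq by blast
qed

lemma uncountable_nat_sets: "uncountable (UNIV :: nat set set)"
proof
  assume "countable (UNIV :: nat set set)"
  then have "range (from_nat_into (UNIV :: nat set set)) = UNIV" by (intro range_from_nat_into) auto
  then show False using Cantors_theorem[of "UNIV :: nat set"] by (metis Pow_UNIV)
qed

text \<open>
  Sets of natural numbers encode the free digits: membership of \<open>j\<close> decides between 0 and 2 at
  the position \<open>m * j\<close>. The filler 1 is the only odd digit in base 3, so that free odd digits
  could not be used there.
\<close>
lemma uncountable_digit_choices:
  fixes X :: "real set"
  assumes M: "3 \<le> M" and m: "0 < m"
    and X: "\<And>d x. \<lbrakk>\<And>n. if m dvd n then d n \<in> {0, 2} else d n = 1;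
      expansion M x (address M d)\<rbrakk> \<Longrightarrow> x \<in> X"
  shows "uncountable X"
proof
  assume "countable X"
  define d where "d S n = (if m dvd n then if n div m \<in> S then 2 else 0 else (1::nat))" for S n
  have "\<exists>x. expansion M x (address M (d S))" for S
    using M by (intro address_expansion_exists) (auto simp: d_def)
  then obtain f where f: "\<And>S. expansion M (f S) (address M (d S))" by metis
  have "f S \<in> X" for S by (rule X[OF _ f]) (auto simp: d_def)
  then have "countable (range f)" using \<open>countable X\<close> by (meson countable_subset image_subsetI)
  moreover have "inj f"
  proof (rule injI)
    fix S T assume "f S = f T"
    then have "d S = d T"
      using M f[of S] f[of T] by (intro expansion_even_difference[of M "f S"]) (auto simp: d_def)
    then have "d S (m * j) = d T (m * j)" for j by simp
    then have "(if j \<in> S then 2 else 0) = (if j \<in> T then 2 else (0::nat))" for j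
      using m by (simp add: d_def)
    then have "j \<in> S \<longleftrightarrow> j \<in> T" for j by (metis zero_neq_numeral)
    then show "S = T" by blast
  qed
  ultimately have "countable (UNIV :: nat set set)" by (rule countable_image_inj_on)
  then show False using uncountable_nat_sets by simp
qed

section \<open>Digit products at almost every point\<close>

lemma sum_over_children:
  fixes f :: "nat \<Rightarrow> nat \<Rightarrow> real"
  assumes "0 < M"
  shows "(\<Sum>k<M ^ Suc n. f (k div M) (k mod M)) = (\<Sum>q<M ^ n. \<Sum>i<M. f q i)"
proof -
  have "(\<Sum>k<M ^ Suc n. f (k div M) (k mod M))
      = (\<Sum>q<M ^ n. \<Sum>k\<in>{q * M..<q * M + M}. f (k div M) (k mod M))"
    by (simp only: sum.nat_group) (simp add: mult.commute)
  also have "\<dots> = (\<Sum>q<M ^ n. \<Sum>i<M. f q i)"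
  proof (rule sum.cong[OF refl])
    fix q
    show "(\<Sum>k\<in>{q * M..<q * M + M}. f (k div M) (k mod M)) = (\<Sum>i<M. f q i)"
      using assms sum.shift_bounds_nat_ivl[of "\<lambda>k. f (k div M) (k mod M)" 0 "q * M" M]
      by (simp add: atLeast0LessThan add.commute)
  qed
  finally show ?thesis .
qed

text \<open>
  Up to the factor \<open>1 / M ^ n\<close>, summation over the cells of level \<open>n\<close> is the expectation under
  Lebesgue measure; the identity expresses that the digits are independent.
\<close>
lemma sum_digit_prod:
  assumes "0 < M"
  shows "(\<Sum>k<M ^ n. digit_prod M w n k) = (\<Sum>i<M. w i) ^ n"
proof (induction n)
  case (Suc n)
  have "(\<Sum>k<M ^ Suc n. digit_prod M w (Suc n) k) = (\<Sum>q<M ^ n. \<Sum>i<M. digit_prod M w n q * w i)"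
    by (simp only: digit_prod.simps sum_over_children[OF assms, of "\<lambda>q i. digit_prod M w n q * w i"])
  then show ?case using Suc by (simp add: sum_distrib_left[symmetric] sum_distrib_right[symmetric] mult.commute)
qed simp

lemma digit_prod_pos:
  assumes "0 < M" "\<And>i. i < M \<Longrightarrow> 0 < w i"
  shows "0 < digit_prod M w n k"
  using assms by (induction n arbitrary: k) auto

lemma digit_prod_powr:
  assumes "0 < M" "\<And>i. i < M \<Longrightarrow> 0 < w i"
  shows "digit_prod M (\<lambda>i. w i powr t) n k = digit_prod M w n k powr t"
proof (induction n arbitrary: k)
  case (Suc n)
  have "0 < digit_prod M w n (k div M)" using digit_prod_pos[of M w] assms by blast
  then show ?case using Suc assms by (simp add: powr_mult less_imp_le)
qed simp

lemma cells_measure: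
  assumes "finite A" "0 < M"
  shows "(\<Union>k\<in>A. cell M n k) \<in> lmeasurable"
    and "measure lebesgue (\<Union>k\<in>A. cell M n k) \<le> real (card A) / real M ^ n"
proof -
  have m: "cell M n k \<in> lmeasurable" for k unfolding cell_def by simp
  then show "(\<Union>k\<in>A. cell M n k) \<in> lmeasurable" using assms by (intro fmeasurable.finite_UN) auto
  have "measure lebesgue (\<Union>k\<in>A. cell M n k) \<le> (\<Sum>k\<in>A. measure lebesgue (cell M n k))"
    using assms m by (intro measure_UNION_le) auto
  also have "\<dots> = (\<Sum>k\<in>A. 1 / real M ^ n)"
    using assms by (simp add: cell_def diff_divide_distrib[symmetric] divide_right_mono)
  finally show "measure lebesgue (\<Union>k\<in>A. cell M n k) \<le> real (card A) / real M ^ n" by simp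
qed

text \<open>
  As a function of \<open>t\<close>, the sum of powers has the value \<open>M\<close> and the derivative
  \<open>\<Sum>i<M. ln (w i)\<close> at \<open>t = 0\<close>.
\<close>
lemma moment_less_one:
  fixes w :: "nat \<Rightarrow> real"
  assumes M: "0 < M" and w: "\<And>i. i < M \<Longrightarrow> 0 < w i" and neg: "(\<Sum>i<M. ln (w i)) < 0"
  shows "\<exists>t>0. (\<Sum>i<M. w i powr t) < real M"
proof -
  have "((\<lambda>t. \<Sum>i<M. w i powr t) has_real_derivative (\<Sum>i<M. ln (w i))) (at 0)"
  proof (rule DERIV_sum)
    fix i assume "i \<in> {..<M}"
    then have "0 < w i" using w by simp
    then show "((\<lambda>t. w i powr t) has_real_derivative ln (w i)) (at 0)"
      by (auto intro!: derivative_eq_intros)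
  qed
  from DERIV_neg_dec_right[OF this neg] obtain d where d: "d > 0"
    "\<And>h. 0 < h \<Longrightarrow> h < d \<Longrightarrow> (\<Sum>i<M. w i powr h) < (\<Sum>i<M. w i powr 0)" by auto
  have "(\<Sum>i<M. w i powr 0) = (\<Sum>i<M. 1)" using w by (intro sum.cong) (auto simp: less_le)
  then show ?thesis using d(1) d(2)[of "d / 2"] by (intro exI[of _ "d / 2"]) auto
qed

text \<open>
  If \<open>\<rho> < 1\<close> is the mean of \<open>w i powr t\<close>, then the mean of the \<open>t\<close>-th power of the product is
  \<open>\<rho> ^ n\<close>. By Markov's inequality the power exceeds \<open>sqrt \<rho> ^ n\<close> on a set of measure at most
  \<open>sqrt \<rho> ^ n\<close>, and these measures are summable.
\<close>
lemma AE_digit_prod_tendsto_zero: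
  fixes w :: "nat \<Rightarrow> real"
  assumes M: "0 < M" and w: "\<And>i. i < M \<Longrightarrow> 0 < w i" and neg: "(\<Sum>i<M. ln (w i)) < 0"
  shows "AE x in lebesgue. \<forall>k. expansion M x k \<longrightarrow> (\<lambda>n. digit_prod M w n (k n)) \<longlonglongrightarrow> 0"
proof -
  have pos: "0 < digit_prod M w n k" for n k
    using digit_prod_pos[of M w] M w by blast
  obtain t where t: "t > 0" "(\<Sum>i<M. w i powr t) < real M"
    using moment_less_one[of M w] assms by blast
  define \<rho> where "\<rho> = (\<Sum>i<M. w i powr t) / real M"
  have "0 < (\<Sum>i<M. w i powr t)" 
  proof (rule sum_pos)
    show "{..<M} \<noteq> {}" using M by auto
    show "0 < w i powr t" if "i \<in> {..<M}" for i using w[of i] that by simp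
  qed simp
  then have \<rho>: "0 < \<rho>" "\<rho> < 1" using t M by (simp_all add: \<rho>_def)
  define s where "s = sqrt \<rho>"
  have s: "0 < s" "s < 1" "\<rho> = s * s" using \<rho> by (simp_all add: s_def)
  define A where "A n = {k. k < M ^ n \<and> s ^ n \<le> digit_prod M w n k powr t}" for n
  have fin: "finite (A n)" for n by (simp add: A_def)
  have card: "real (card (A n)) / real M ^ n \<le> s ^ n" for n
  proof -
    have "real (card (A n)) * s ^ n = (\<Sum>k\<in>A n. s ^ n)" by simp
    also have "\<dots> \<le> (\<Sum>k\<in>A n. digit_prod M w n k powr t)"
      by (rule sum_mono) (simp add: A_def)
    also have "\<dots> \<le> (\<Sum>k<M ^ n. digit_prod M w n k powr t)"
      by (rule sum_mono2) (auto simp: A_def)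
    also have "\<dots> = (\<Sum>i<M. w i powr t) ^ n"
      by (simp add: digit_prod_powr[of M w, OF M w, symmetric] sum_digit_prod[OF M])
    also have "\<dots> = real M ^ n * s ^ n * s ^ n"
      using M by (simp add: power_mult_distrib[symmetric] mult.assoc s(3)[symmetric]) (simp add: \<rho>_def)
    finally show ?thesis using s M by (simp add: field_simps)
  qed
  have "AE x in lebesgue. eventually (\<lambda>n. x \<in> space lebesgue - (\<Union>k\<in>A n. cell M n k)) sequentially"
  proof (rule borel_cantelli_AE1)
    fix n
    note c = cells_measure[OF fin M, of n n]
    show "(\<Union>k\<in>A n. cell M n k) \<in> sets lebesgue" using c(1) by blast
    show "emeasure lebesgue (\<Union>k\<in>A n. cell M n k) < \<infinity>" using c(1) by (auto simp: fmeasurable_def)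
  next
    show "summable (\<lambda>n. measure lebesgue (\<Union>k\<in>A n. cell M n k))"
    proof (rule summable_comparison_test')
      show "summable (\<lambda>n. s ^ n)" using s by (simp add: summable_geometric)
      show "norm (measure lebesgue (\<Union>k\<in>A n. cell M n k)) \<le> s ^ n" for n
        using cells_measure(2)[OF fin M, of n n] card[of n] by simp
    qed
  qed
  then show ?thesis
  proof (rule AE_mp, intro AE_I2 impI allI)
    fix x k
    assume ev: "eventually (\<lambda>n. x \<in> space lebesgue - (\<Union>k\<in>A n. cell M n k)) sequentially"
      and k: "expansion M x k"
    have le: "eventually (\<lambda>n. digit_prod M w n (k n) \<le> (s powr (1 / t)) ^ n) sequentially"
      using ev
    proof (rule eventually_mono)
      fix n assume "x \<in> space lebesgue - (\<Union>k\<in>A n. cell M n k)"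
      then have "k n \<notin> A n" using k unfolding expansion_def by blast
      then have "digit_prod M w n (k n) powr t \<le> s ^ n"
        using k unfolding expansion_def A_def by force
      then have "(digit_prod M w n (k n) powr t) powr (1 / t) \<le> (s ^ n) powr (1 / t)"
        using t by (intro powr_mono2) auto
      moreover have "(s ^ n) powr (1 / t) = (s powr (1 / t)) ^ n"
        using s by (simp add: powr_realpow[symmetric] powr_powr mult.commute)
      ultimately show "digit_prod M w n (k n) \<le> (s powr (1 / t)) ^ n"
        using t pos[of n "k n"] by (simp add: powr_powr)
    qed
    have "s powr (1 / t) < 1" using s t powr_less_mono2[of "1/t" s 1] by simp
    then have lim: "(\<lambda>n. (s powr (1 / t)) ^ n) \<longlonglongrightarrow> 0" by (intro LIMSEQ_realpow_zero) auto
    have "eventually (\<lambda>n. 0 \<le> digit_prod M w n (k n)) sequentially"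
      using pos by (simp add: less_imp_le)
    then show "(\<lambda>n. digit_prod M w n (k n)) \<longlonglongrightarrow> 0"
      by (rule tendsto_sandwich[OF _ le tendsto_const lim])
  qed
qed

text \<open>
  The walk with the steps \<open>v i\<close>, stopped as soon as it exceeds the level \<open>c\<close>, as a function of the
  cell \<open>k\<close> of level \<open>n\<close>.
\<close>
fun stopped_sum :: "nat \<Rightarrow> (nat \<Rightarrow> real) \<Rightarrow> real \<Rightarrow> nat \<Rightarrow> nat \<Rightarrow> real" where
  "stopped_sum M v c 0 k = 0"
| "stopped_sum M v c (Suc n) k =
    (let t = stopped_sum M v c n (k div M) in if c < t then t else t + v (k mod M))"

lemma stopped_sum_le:
  assumes "0 < M" "0 \<le> c" "0 \<le> K" "\<And>i. i < M \<Longrightarrow> v i \<le> K"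
  shows "stopped_sum M v c n k \<le> c + K"
proof (induction n arbitrary: k)
  case (Suc n)
  show ?case using Suc[of "k div M"] assms(4)[of "k mod M"] assms(1) by (auto simp: Let_def)
qed (use assms in auto)

text \<open>
  The \<open>M\<close> subcells of a cell either inherit its value unchanged or add the steps \<open>v i\<close> to it, one
  each, and the steps have a nonnegative sum: the stopped walk is a submartingale.
\<close>
lemma sum_stopped_sum_nonneg:
  assumes M: "0 < M" and v: "0 \<le> (\<Sum>i<M. v i)"
  shows "0 \<le> (\<Sum>k<M ^ n. stopped_sum M v c n k)"
proof (induction n)
  case (Suc n)
  let ?f = "\<lambda>q i. if c < stopped_sum M v c n q then stopped_sum M v c n q
    else stopped_sum M v c n q + v i"
  have "0 \<le> real M * (\<Sum>q<M ^ n. stopped_sum M v c n q)" using Suc by simp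
  also have "\<dots> = (\<Sum>q<M ^ n. \<Sum>i<M. stopped_sum M v c n q)" by (simp add: sum_distrib_left)
  also have "\<dots> \<le> (\<Sum>q<M ^ n. \<Sum>i<M. ?f q i)"
  proof (rule sum_mono)
    fix q
    show "(\<Sum>i<M. stopped_sum M v c n q) \<le> (\<Sum>i<M. ?f q i)"
      using v by (cases "c < stopped_sum M v c n q") (simp_all add: sum.distrib)
  qed
  also have "\<dots> = (\<Sum>k<M ^ Suc n. ?f (k div M) (k mod M))"
    by (rule sum_over_children[OF M, symmetric])
  finally show ?case by (simp add: Let_def)
qed simp

text \<open>
  The stopped walk is at most \<open>c + K\<close> and its mean is nonnegative, so that it can be at most \<open>- L\<close>
  only on a proportion \<open>(c + K) / L\<close> of the cells, whatever their level.
\<close>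
lemma card_stopped_sum_le:
  assumes M: "0 < M" and v: "0 \<le> (\<Sum>i<M. v i)" and c: "0 \<le> c" "0 \<le> K" "\<And>i. i < M \<Longrightarrow> v i \<le> K"
    and L: "0 < L"
  shows "real (card {k. k < M ^ n \<and> stopped_sum M v c n k \<le> - L}) / real M ^ n \<le> (c + K) / L"
proof -
  let ?A = "{k. k < M ^ n \<and> stopped_sum M v c n k \<le> - L}"
  have "stopped_sum M v c n k \<le> (c + K) - (if k \<in> ?A then L else 0)" if "k < M ^ n" for k
    using stopped_sum_le[of M c K v n k] that assms by auto
  then have "(\<Sum>k<M ^ n. stopped_sum M v c n k) \<le> (\<Sum>k<M ^ n. (c + K) - (if k \<in> ?A then L else 0))"
    by (intro sum_mono) simp
  also have "\<dots> = real M ^ n * (c + K) - (\<Sum>k<M ^ n. if k \<in> ?A then L else 0)"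
    by (simp add: sum_subtractf)
  also have "(\<Sum>k<M ^ n. if k \<in> ?A then L else 0) = (\<Sum>k\<in>{..<M ^ n} \<inter> ?A. L)"
    by (rule sum.inter_restrict[symmetric]) simp
  also have "{..<M ^ n} \<inter> ?A = ?A" by auto
  finally have "real (card ?A) * L \<le> real M ^ n * (c + K)"
    using sum_stopped_sum_nonneg[OF M v, of c n] by simp
  then show ?thesis using L M by (simp add: field_simps)
qed

lemma stopped_sum_eq_ln_digit_prod:
  assumes M: "0 < M" and w: "\<And>i. i < M \<Longrightarrow> 0 < w i"
    and k: "expansion M x k" and le: "\<And>n::nat. ln (digit_prod M w n (k n)) \<le> c"
  shows "stopped_sum M (\<lambda>i. ln (w i)) c n (k n) = ln (digit_prod M w n (k n))"
proof -
  have pos: "0 < digit_prod M w n k" for n k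
    using digit_prod_pos[of M w] M w by blast
  show ?thesis
  proof (induction n)
    case (Suc n)
    have "k (Suc n) div M = k n" using k by (simp add: expansion_def)
    then show ?case
      using Suc le[of n] pos[of n "k n"] w[of "k (Suc n) mod M"] M
      by (auto simp: Let_def ln_mult)
  qed simp
qed

text \<open>
  Let \<open>K\<close> be an upper bound of the steps \<open>ln (w i)\<close>. Where the products tend to 0, their logarithms are bounded above by some natural number \<open>c\<close>. They then
  coincide with the walk stopped above \<open>c\<close>, which ends up below every level \<open>- L\<close>; by
  \<open>card_stopped_sum_le\<close> this happens on a set of measure at most \<open>(c + K) / L\<close>, for every \<open>L\<close>.
\<close>
lemma AE_not_digit_prod_tendsto_zero:
  fixes w :: "nat \<Rightarrow> real"
  assumes M: "0 < M" and w: "\<And>i. i < M \<Longrightarrow> 0 < w i" and nonneg: "0 \<le> (\<Sum>i<M. ln (w i))"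
  shows "AE x in lebesgue. \<forall>k. expansion M x k \<longrightarrow> \<not> (\<lambda>n. digit_prod M w n (k n)) \<longlonglongrightarrow> 0"
proof -
  let ?P = "\<lambda>n k. digit_prod M w n k"
  have pos: "0 < digit_prod M w n k" for n k
    using digit_prod_pos[of M w] M w by blast
  define T where "T c = stopped_sum M (\<lambda>i. ln (w i)) (real c)" for c :: nat
  define E where "E c = {x. \<exists>k. expansion M x k \<and> (\<forall>n. ln (?P n (k n)) \<le> real c)
    \<and> (\<lambda>n. ?P n (k n)) \<longlonglongrightarrow> 0}" for c :: nat
  define K where "K = (\<Sum>i<M. \<bar>ln (w i)\<bar>)"
  have K: "0 \<le> K" "\<And>i. i < M \<Longrightarrow> ln (w i) \<le> K"
  proof -
    show "0 \<le> K" by (simp add: K_def sum_nonneg)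
    show "ln (w i) \<le> K" if "i < M" for i
      using member_le_sum[of i "{..<M}" "\<lambda>i. \<bar>ln (w i)\<bar>"] that unfolding K_def by auto
  qed
  have E: "negligible (E c)" for c
    unfolding negligible_outer_le
  proof (intro allI impI)
    fix e :: real assume e: "0 < e"
    define L where "L = (real c + K + 1) / e"
    have "0 < real c + K + 1" using K by linarith
    then have L: "0 < L" "(real c + K) / L \<le> e" using e K(1) by (simp_all add: L_def field_simps)
    define A where "A n = {k. k < M ^ n \<and> T c n k \<le> - L}" for n
    define G where "G n = (\<Union>k\<in>A n. cell M n k)" for n
    \<comment> \<open>the cells on which the walk stays below \<open>- L\<close> from level \<open>m\<close> on; they increase with \<open>m\<close>, so
      that their union still has measure at most \<open>e\<close>\<close>
    define H where "H m = (\<Inter>n\<in>{m..}. G n)" for m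
    have fin: "finite (A n)" for n by (simp add: A_def)
    have G: "G n \<in> lmeasurable" "measure lebesgue (G n) \<le> e" for n
    proof -
      show "G n \<in> lmeasurable" unfolding G_def by (rule cells_measure(1)[OF fin M])
      have "measure lebesgue (G n) \<le> real (card (A n)) / real M ^ n"
        unfolding G_def by (rule cells_measure(2)[OF fin M])
      also have "\<dots> \<le> (real c + K) / L"
        unfolding A_def T_def using K L by (intro card_stopped_sum_le[OF M nonneg]) auto
      finally show "measure lebesgue (G n) \<le> e" using L by linarith
    qed
    have HG: "H m \<subseteq> G m" for m by (auto simp: H_def)
    have "H m \<in> sets lebesgue" for m
      unfolding H_def using G by (intro sets.countable_INT') auto
    then have Hm: "H m \<in> lmeasurable" for m
      using HG G(1) by (meson fmeasurableI2)
    have He: "measure lebesgue (H m) \<le> e" for m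
      using measure_mono_fmeasurable[OF HG _ G(1), of m] Hm[of m] G(2)[of m] by auto
    have nest: "H m \<subseteq> H (Suc m)" for m by (auto simp: H_def)
    have "(\<Union>m. H m) \<in> lmeasurable" by (rule measurable_nested_Union[of H e]) (fact Hm He nest)+
    moreover have "measure lebesgue (\<Union>m. H m) \<le> e"
      using measure_nested_Union[of H e, OF Hm He nest] He by (intro LIMSEQ_le_const2) auto
    moreover have "E c \<subseteq> (\<Union>m. H m)"
    proof
      fix x assume "x \<in> E c"
      then obtain k where k: "expansion M x k" "\<And>n. ln (?P n (k n)) \<le> real c" "(\<lambda>n. ?P n (k n)) \<longlonglongrightarrow> 0"
        by (auto simp: E_def)
      have "eventually (\<lambda>n. ?P n (k n) < exp (- L)) sequentially"
        using k(3) by (rule order_tendstoD) simp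
      then obtain m where m: "\<And>n. n \<ge> m \<Longrightarrow> ?P n (k n) < exp (- L)"
        by (auto simp: eventually_sequentially)
      have "x \<in> G n" if "n \<ge> m" for n
      proof -
        have "ln (?P n (k n)) \<le> - L"
          using m[OF that] pos[of n "k n"] ln_mono[of "?P n (k n)" "exp (- L)"] by simp
        then have "T c n (k n) \<le> - L"
          unfolding T_def using stopped_sum_eq_ln_digit_prod[of M w, OF M w k(1,2)] by simp
        then show ?thesis using k(1) unfolding G_def A_def expansion_def by auto
      qed
      then show "x \<in> (\<Union>m. H m)" by (auto simp: H_def)
    qed
    ultimately show "\<exists>T. E c \<subseteq> T \<and> T \<in> lmeasurable \<and> measure lebesgue T \<le> e" by blast
  qed
  have "x \<in> (\<Union>c. E c)" if k: "expansion M x k" "(\<lambda>n. ?P n (k n)) \<longlonglongrightarrow> 0" for x k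
  proof -
    obtain B where B: "\<And>n. norm (?P n (k n)) \<le> B" using Bseq_def k(2) convergent_imp_Bseq convergentI by metis
    obtain c :: nat where c: "ln B \<le> real c" using real_arch_simple by blast
    have "ln (?P n (k n)) \<le> real c" for n
    proof -
      have "0 < ?P n (k n)" "?P n (k n) \<le> B" using pos[of n "k n"] B[of n] by auto
      then have "ln (?P n (k n)) \<le> ln B" by simp
      then show ?thesis using c by linarith
    qed
    then show ?thesis using k by (auto simp: E_def)
  qed
  then have bad: "{x \<in> space lebesgue. \<not> (\<forall>k. expansion M x k \<longrightarrow> \<not> (\<lambda>n. ?P n (k n)) \<longlonglongrightarrow> 0)} \<subseteq> (\<Union>c. E c)"
    by blast
  have "(\<Union>c. E c) \<in> null_sets lebesgue"
    using E negligible_iff_null_sets by blast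
  then show ?thesis using bad by (rule AE_I')
qed

text \<open>
  Passing from \<open>k\<close> to \<open>Suc k\<close> either changes the last digit only, which costs a factor between
  \<open>1 / R\<close> and \<open>R\<close>, or carries. In the latter case the last digits \<open>M - 1\<close> and 0 have
  the same weight, and the question is the same one for the parent cells: the factor \<open>R\<close> is paid only once.
\<close>
lemma digit_prod_neighbour:
  assumes M: "0 < M" and pos: "\<And>i. i < M \<Longrightarrow> 0 < w i"
    and ratio: "\<And>i j. i < M \<Longrightarrow> j < M \<Longrightarrow> w i \<le> R * w j" and ends: "w (M - 1) = w 0"
  shows "digit_prod M w n k \<le> R * digit_prod M w n (Suc k)"
    and "digit_prod M w n (Suc k) \<le> R * digit_prod M w n k"
proof -
  have p: "0 < digit_prod M w n k" for n k using digit_prod_pos[of M w] M pos by blast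
  have "w 0 \<le> R * w 0" using ratio[of 0 0] M by simp
  then have R: "1 \<le> R" using pos[of 0] M by simp
  have "digit_prod M w n k \<le> R * digit_prod M w n (Suc k)
    \<and> digit_prod M w n (Suc k) \<le> R * digit_prod M w n k"
  proof (induction n arbitrary: k)
    case (Suc n)
    show ?case
    proof (cases "Suc (k mod M) = M")
      case True
      then have "k mod M = M - 1" "Suc k mod M = 0" "Suc k div M = Suc (k div M)"
        by (auto simp: mod_Suc div_Suc)
      moreover have "0 < w 0" using pos M by simp
      ultimately show ?thesis using Suc[of "k div M"] ends
        by (simp add: mult.assoc[symmetric])
    next
      case False
      then have "Suc k mod M = Suc (k mod M)" "Suc k div M = k div M"
        by (auto simp: mod_Suc div_Suc)
      moreover have "k mod M < M" "Suc (k mod M) < M"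
        using False M by (auto simp: Suc_lessI)
      ultimately show ?thesis
        using ratio[of "k mod M" "Suc (k mod M)"] ratio[of "Suc (k mod M)" "k mod M"]
          p[of n "k div M"]
        by (simp add: mult.left_commute[of R])
    qed
  qed (use R in simp)
  then show "digit_prod M w n k \<le> R * digit_prod M w n (Suc k)"
    and "digit_prod M w n (Suc k) \<le> R * digit_prod M w n k" by blast+
qed

section \<open>Self-affinity and the differentiability criterion\<close>

text \<open>
  The interval has length \<open>(v n - x) + (x - u n)\<close>, without cancellation because \<open>x\<close> lies in it;
  hence the errors of the linear approximation at both ends stay small relative to the length.
\<close>
lemma straddling_difference_quotients:
  fixes f :: "real \<Rightarrow> real"
  assumes D: "(f has_real_derivative D) (at x within S)"
    and S: "\<And>n. u n \<in> S" "\<And>n. v n \<in> S"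
    and x: "\<And>n::nat. u n \<le> x" "\<And>n. x \<le> v n" "\<And>n. u n < v n"
    and lim: "(\<lambda>n. v n - u n) \<longlonglongrightarrow> 0"
  shows "(\<lambda>n. (f (v n) - f (u n)) / (v n - u n)) \<longlonglongrightarrow> D"
proof (rule LIMSEQ_I)
  fix e :: real assume e: "0 < e"
  have "(f has_derivative (*) D) (at x within S)" using D by (simp add: has_field_derivative_def)
  then obtain d where d: "d > 0"
    "\<And>y. y \<in> S \<Longrightarrow> norm (y - x) < d \<Longrightarrow> norm (f y - f x - D * (y - x)) \<le> e / 2 * norm (y - x)"
    using e unfolding has_derivative_within_alt by (metis half_gt_zero)
  obtain n0 where n0: "\<And>n. n \<ge> n0 \<Longrightarrow> norm (v n - u n) < d"
    using LIMSEQ_D[OF lim d(1)] by auto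
  show "\<exists>n0. \<forall>n\<ge>n0. norm ((f (v n) - f (u n)) / (v n - u n) - D) < e"
  proof (intro exI allI impI)
    fix n assume n: "n \<ge> n0"
    define h where "h = v n - u n"
    have h: "0 < h" using x(3)[of n] by (simp add: h_def)
    have "norm (u n - x) < d" "norm (v n - x) < d" using n0[OF n] x[of n] by auto
    then have "\<bar>f (u n) - f x - D * (u n - x)\<bar> \<le> e / 2 * (x - u n)"
      and "\<bar>f (v n) - f x - D * (v n - x)\<bar> \<le> e / 2 * (v n - x)"
      using d(2)[OF S(1), of n] d(2)[OF S(2), of n] x[of n] by auto
    then have "\<bar>(f (v n) - f x - D * (v n - x)) - (f (u n) - f x - D * (u n - x))\<bar>
        \<le> e / 2 * (v n - x) + e / 2 * (x - u n)" by linarith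
    moreover have "(f (v n) - f x - D * (v n - x)) - (f (u n) - f x - D * (u n - x))
        = f (v n) - f (u n) - D * h"
      by (simp add: h_def algebra_simps)
    moreover have "e / 2 * (v n - x) + e / 2 * (x - u n) = e / 2 * h"
      by (simp add: h_def distrib_left[symmetric])
    ultimately have "\<bar>f (v n) - f (u n) - D * h\<bar> \<le> e / 2 * h" by simp
    moreover have "(f (v n) - f (u n)) / h - D = (f (v n) - f (u n) - D * h) / h"
      using h by (simp add: field_simps)
    ultimately have "\<bar>(f (v n) - f (u n)) / h - D\<bar> \<le> e / 2"
      using h by (simp add: abs_divide divide_le_eq)
    then show "norm ((f (v n) - f (u n)) / (v n - u n) - D) < e" using e by (simp add: h_def)
  qed
qed

locale self_affine_family =
  fixes N :: nat and a :: real
  assumes N_pos: "N > 0" and a_gt: "a_min N < a" and a_less: "a < 1"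
begin

definition M :: nat where "M = 2 * N + 1"

abbreviation b :: real where "b \<equiv> b_par N a"

definition step :: "nat \<Rightarrow> real" where "step i = (if even i then a else - b)"

definition slope :: "nat \<Rightarrow> real" where "slope i = real M * \<bar>step i\<bar>"

lemma M: "0 < M" "3 \<le> M" "real M = 2 * real N + 1"
  using N_pos by (auto simp: M_def)

lemma b_bounds: "0 < b" "b < a"
proof -
  have "(real N + 1) * a > 1" using a_gt by (simp add: a_min_def field_simps)
  then show "0 < b" "b < a"
    using N_pos a_less by (simp_all add: b_par_def field_simps)
qed

lemma a_pos: "0 < a" using b_bounds by linarith

lemma Ma_gt: "1 < real M * a"
proof -
  have "1 < (real N + 1) * a" using a_gt by (simp add: a_min_def field_simps)
  also have "\<dots> \<le> real M * a" using a_pos by (intro mult_right_mono) (auto simp: M)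
  finally show ?thesis .
qed

lemma slope_eq: "slope i = (if even i then real M * a else real M * b)"
  using b_bounds by (auto simp: slope_def step_def)

lemma slope_pos: "0 < slope i"
  using b_bounds M by (auto simp: slope_eq)

lemma slope_prod_pos: "0 < digit_prod M slope n k"
  using digit_prod_pos[of M slope] slope_pos M by blast

lemma digit_prod_slope: "digit_prod M slope n k = real M ^ n * \<bar>digit_prod M step n k\<bar>"
  by (induction n arbitrary: k) (auto simp: slope_def abs_mult)

lemma F_tendsto:
  assumes "x \<in> {0..1}"
  shows "(\<lambda>n. fseq N a n x) \<longlonglongrightarrow> F N a x"
  using uniform_limit_F[OF N_pos a_gt a_less] assms by (rule tendsto_uniform_limitI)

lemma F_0: "F N a 0 = 0" and F_1: "F N a 1 = 1"
  using F_tendsto[of 0] F_tendsto[of 1]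
  by (simp_all add: fseq_0 fseq_1[OF N_pos] LIMSEQ_const_iff)

lemma F_bounds:
  assumes "x \<in> {0..1}"
  shows "F N a x \<in> {0..1}"
proof -
  have "fseq N a n x \<in> {0..1}" for n
    using a_pos a_less assms by (intro fseq_bounds N_pos) auto
  then show ?thesis using F_tendsto[OF assms]
    by (auto intro: LIMSEQ_le_const LIMSEQ_le_const2)
qed

lemma F_piece:
  assumes i: "i < M" and t: "t \<in> {0..1}"
  shows "F N a ((real i + t) / real M) = ynode N a i + step i * F N a t"
proof -
  let ?x = "(real i + t) / real M"
  have iM: "real i + 1 \<le> real M" using i by linarith
  have x01: "?x \<in> {0..1}" using t iM M by auto
  have "(\<lambda>n. fseq N a (Suc n) ?x) \<longlonglongrightarrow> F N a ?x"
    by (rule LIMSEQ_Suc[OF F_tendsto[OF x01]])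
  moreover have "fseq N a (Suc n) ?x = ynode N a i + step i * fseq N a n t" for n
  proof -
    have "(2 * real N + 1) * (?x - xnode N i) = real M * ?x - real i"
      by (simp only: rescale M(3))
    then have "(2 * real N + 1) * (?x - xnode N i) = t" using M(1) by simp
    moreover have "xnode N i \<le> ?x" "?x \<le> xnode N (Suc i)"
      using t M by (auto simp: xnode_def intro!: divide_right_mono)
    moreover have "i \<le> 2 * N" using i by (simp add: M_def)
    ultimately show ?thesis
      using fseq_rec[OF N_pos, of i ?x a n] by (simp add: ynode_step step_def del: fseq.simps)
  qed
  moreover have "(\<lambda>n. ynode N a i + step i * fseq N a n t) \<longlonglongrightarrow> ynode N a i + step i * F N a t"
    by (intro tendsto_intros F_tendsto t)
  ultimately show ?thesis using LIMSEQ_unique by auto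
qed

lemma F_cell:
  assumes "k < M ^ n" "t \<in> {0..1}"
  shows "F N a ((real k + t) / real M ^ n) = F N a (real k / real M ^ n) + digit_prod M step n k * F N a t"
  using assms
proof (induction n arbitrary: k t)
  case 0
  then show ?case by (simp add: F_0)
next
  case (Suc n)
  define q i where "q = k div M" and "i = k mod M"
  have i: "i < M" using M by (simp add: i_def)
  have k: "real k = real M * real q + real i"
    unfolding q_def i_def by (metis mult_div_mod_eq of_nat_add of_nat_mult)
  have q: "q < M ^ n" using Suc.prems(1) by (simp add: q_def less_mult_imp_div_less mult.commute)
  have eq: "F N a ((real k + s) / real M ^ Suc n)
      = F N a (real q / real M ^ n) + digit_prod M step n q * (ynode N a i + step i * F N a s)"
    if s: "s \<in> {0..1}" for s
  proof -
    have "(real k + s) / real M ^ Suc n = (real q + (real i + s) / real M) / real M ^ n"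
      using M by (simp add: k field_simps)
    moreover have "real i + 1 \<le> real M" using i by linarith
    then have "(real i + s) / real M \<in> {0..1}" using s M by auto
    ultimately show ?thesis using Suc.IH[OF q] F_piece[OF i s] by simp
  qed
  show ?case using eq[OF Suc.prems(2)] eq[of 0]
    by (simp add: F_0 q_def[symmetric] i_def[symmetric] algebra_simps)
qed

lemma F_cell_oscillation:
  assumes k: "k < M ^ n" and x: "x \<in> cell M n k" and y: "y \<in> cell M n k"
  shows "\<bar>F N a x - F N a y\<bar> \<le> digit_prod M slope n k / real M ^ n"
proof -
  have "\<exists>t\<in>{0..1}. F N a z = F N a (real k / real M ^ n) + digit_prod M step n k * F N a t"
    if "z \<in> cell M n k" for z
  proof
    let ?t = "real M ^ n * z - real k"
    show t: "?t \<in> {0..1}" using that by (auto simp: in_cell_iff[OF M(1)])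
    have "z = (real k + ?t) / real M ^ n" using M by simp
    then show "F N a z = F N a (real k / real M ^ n) + digit_prod M step n k * F N a ?t"
      using F_cell[OF k t] by simp
  qed
  from this[OF x] this[OF y] obtain s t where st: "s \<in> {0..1}" "t \<in> {0..1}"
    and "F N a x - F N a y = digit_prod M step n k * (F N a s - F N a t)"
    by (auto simp: algebra_simps)
  then have "\<bar>F N a x - F N a y\<bar> = \<bar>digit_prod M step n k\<bar> * \<bar>F N a s - F N a t\<bar>"
    by (simp add: abs_mult)
  also have "\<dots> \<le> \<bar>digit_prod M step n k\<bar> * 1"
    using F_bounds[OF st(1)] F_bounds[OF st(2)] by (intro mult_left_mono) auto
  finally show ?thesis using M by (simp add: digit_prod_slope)
qed

lemma cell_subset_unit:
  assumes "k < M ^ n"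
  shows "cell M n k \<subseteq> {0..1}"
proof -
  have "real k + 1 \<le> real M ^ n" using assms by (metis Suc_leI of_nat_Suc of_nat_le_iff of_nat_power add.commute)
  then have "(real k + 1) / real M ^ n \<le> 1" using M by simp
  then show ?thesis unfolding cell_def by auto
qed

text \<open>
  For \<open>y \<noteq> x\<close> take the level \<open>n\<close> with \<open>1 / M ^ Suc n \<le> \<bar>y - x\<bar> < 1 / M ^ n\<close>. Then \<open>y\<close> lies in
  the cell of \<open>x\<close> at level \<open>n\<close> or in one of the two adjacent ones, and the oscillation of \<open>F N a\<close>
  over these cells is controlled by the slope of the cell of \<open>x\<close>.
\<close>
lemma F_derivative_zero:
  assumes k: "expansion M x k" and lim: "(\<lambda>n. digit_prod M slope n (k n)) \<longlonglongrightarrow> 0"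
  shows "(F N a has_real_derivative 0) (at x within {0..1})"
  unfolding has_field_derivative_def has_derivative_within_alt
proof (intro conjI allI impI)
  show "bounded_linear ((*) (0 :: real))" by (rule bounded_linear_mult_right)
next
  fix e :: real assume e: "0 < e"
  let ?P = "digit_prod M slope"
  define R where "R = a / b"
  have R: "1 \<le> R" using b_bounds by (simp add: R_def)
  have neighbour: "?P n j \<le> R * ?P n (Suc j)" "?P n (Suc j) \<le> R * ?P n j" for n j
  proof -
    have "slope i \<le> R * slope j" for i j
    proof -
      have "real M * b \<le> real M * a" using b_bounds by (intro mult_left_mono) auto
      then have "slope i \<le> real M * a" "real M * b \<le> slope j" by (auto simp: slope_eq)
      moreover have "real M * a = R * (real M * b)" using b_bounds by (simp add: R_def)
      moreover have "R * (real M * b) \<le> R * slope j" using calculation(2) R by (intro mult_left_mono) auto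
      ultimately show ?thesis by linarith
    qed
    moreover have "slope (M - 1) = slope 0" by (simp add: slope_eq M_def)
    ultimately show "?P n j \<le> R * ?P n (Suc j)" "?P n (Suc j) \<le> R * ?P n j"
      using digit_prod_neighbour[of M slope R n j] M slope_pos by blast+
  qed
  define \<epsilon> where "\<epsilon> = e / ((1 + R) * real M)"
  have "0 < \<epsilon>" using e R M by (simp add: \<epsilon>_def)
  from LIMSEQ_D[OF lim this] obtain n0 where "\<And>n. n \<ge> n0 \<Longrightarrow> norm (?P n (k n) - 0) < \<epsilon>"
    by blast
  then have n0: "?P n (k n) < \<epsilon>" if "n \<ge> n0" for n using that by force
  show "\<exists>d>0. \<forall>y\<in>{0..1}. norm (y - x) < d \<longrightarrow>
      norm (F N a y - F N a x - 0 * (y - x)) \<le> e * norm (y - x)"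
  proof (intro exI[of _ "1 / real M ^ n0"] conjI ballI impI)
    show "0 < 1 / real M ^ n0" using M by simp
    fix y :: real assume y: "y \<in> {0..1}" "norm (y - x) < 1 / real M ^ n0"
    show "norm (F N a y - F N a x - 0 * (y - x)) \<le> e * norm (y - x)"
    proof (cases "y = x")
      case False
      define h where "h = \<bar>y - x\<bar>"
      have h: "0 < h" using False by (simp add: h_def)
      have "\<exists>n. 1 / real M ^ Suc n \<le> h"
      proof -
        obtain n where "(1 / real M) ^ n < h" using real_arch_pow_inv[OF h, of "1 / real M"] M by auto
        moreover have "(1 / real M) ^ Suc n \<le> (1 / real M) ^ n"
          using M by (intro power_decreasing) auto
        ultimately show ?thesis by (intro exI[of _ n]) (simp add: power_one_over)
      qed
      define n where "n = (LEAST n. 1 / real M ^ Suc n \<le> h)"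
      have n: "1 / real M ^ Suc n \<le> h" unfolding n_def by (rule LeastI_ex) fact
      have n': "h < 1 / real M ^ n"
      proof (cases n)
        case 0
        have "1 / real M ^ n0 \<le> 1" using M by simp
        then show ?thesis using y(2) 0 by (simp add: h_def)
      next
        case (Suc m)
        then have "m < n" by simp
        then have "\<not> 1 / real M ^ Suc m \<le> h" unfolding n_def by (rule not_less_Least)
        then show ?thesis using Suc by simp
      qed
      have "n0 \<le> n"
      proof (rule ccontr)
        assume "\<not> n0 \<le> n"
        then have "1 / real M ^ n0 \<le> 1 / real M ^ Suc n"
          using M by (intro divide_left_mono power_increasing) auto
        then show False using n y(2) by (simp add: h_def)
      qed
      define z where "z = real M ^ n * y"
      have kn: "k n < M ^ n" and xk: "x \<in> cell M n (k n)"
        using k unfolding expansion_def by blast+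
      have hn: "\<bar>real M ^ n * y - real M ^ n * x\<bar> < 1"
      proof -
        have "\<bar>real M ^ n * y - real M ^ n * x\<bar> = real M ^ n * h"
          by (simp add: h_def right_diff_distrib[symmetric] abs_mult)
        then show ?thesis using n' M(1) by (simp add: pos_less_divide_eq mult.commute)
      qed
      have zx: "real (k n) \<le> real M ^ n * x" "real M ^ n * x \<le> real (k n) + 1"
        using xk by (auto simp: in_cell_iff[OF M(1)])
      let ?B = "(1 + R) * ?P n (k n) / real M ^ n"
      \<comment> \<open>the path from \<open>y\<close> to \<open>x\<close> goes through a point \<open>w\<close> common to their cells\<close>
      have split: "\<bar>F N a y - F N a x\<bar> \<le> ?B"
        if j: "j < M ^ n" "?P n j \<le> R * ?P n (k n)" and w: "w \<in> cell M n j" "w \<in> cell M n (k n)"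
          and yj: "y \<in> cell M n j" for j w
      proof -
        have "\<bar>F N a y - F N a w\<bar> \<le> ?P n j / real M ^ n"
          by (rule F_cell_oscillation[OF j(1) yj w(1)])
        also have "\<dots> \<le> R * ?P n (k n) / real M ^ n" using j(2) M by (intro divide_right_mono) auto
        finally have "\<bar>F N a y - F N a w\<bar> \<le> R * ?P n (k n) / real M ^ n" .
        moreover have "\<bar>F N a w - F N a x\<bar> \<le> ?P n (k n) / real M ^ n"
          by (rule F_cell_oscillation[OF kn w(2) xk])
        moreover have "?B = ?P n (k n) / real M ^ n + R * ?P n (k n) / real M ^ n"
          by (simp add: distrib_right add_divide_distrib)
        ultimately show ?thesis by linarith
      qed
      have "\<bar>F N a y - F N a x\<bar> \<le> ?B"
      proof (cases "real (k n) \<le> z")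
        case False
        moreover have "0 \<le> z" using y(1) by (simp add: z_def)
        ultimately have "k n \<noteq> 0" by (intro notI) simp
        then obtain j where j: "k n = Suc j" by (cases "k n") auto
        show ?thesis
        proof (rule split[of j "real (k n) / real M ^ n"])
          show "j < M ^ n" using j kn by simp
          show "?P n j \<le> R * ?P n (k n)" unfolding j by (rule neighbour)
          show "y \<in> cell M n j" using False hn zx j by (simp add: in_cell_iff[OF M(1)] z_def)
        qed (use j M(1) in \<open>auto simp: in_cell_iff\<close>)
      next
        case True
        show ?thesis
        proof (cases "z \<le> real (k n) + 1")
          case True
          have "?P n (k n) \<le> R * ?P n (k n)" using R slope_prod_pos[of n "k n"] by simp
          then show ?thesis
            using True \<open>real (k n) \<le> z\<close> xk kn
            by (intro split[of "k n" x]) (auto simp: in_cell_iff[OF M(1)] z_def)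
        next
          case False
          have "z \<le> real M ^ n * 1" unfolding z_def using y(1) M by (intro mult_left_mono) auto
          then have "real (Suc (k n)) < real (M ^ n)" using False by simp
          then have "Suc (k n) < M ^ n" by (simp only: of_nat_less_iff)
          show ?thesis
          proof (rule split[of "Suc (k n)" "(real (k n) + 1) / real M ^ n"])
            show "Suc (k n) < M ^ n" by fact
            show "?P n (Suc (k n)) \<le> R * ?P n (k n)" by (rule neighbour)
            show "y \<in> cell M n (Suc (k n))"
              using False hn zx by (simp add: in_cell_iff[OF M(1)] z_def)
          qed (use M(1) in \<open>auto simp: in_cell_iff\<close>)
        qed
      qed
      also have "?B \<le> (1 + R) * \<epsilon> / real M ^ n"
        using n0[OF \<open>n0 \<le> n\<close>] R M by (intro divide_right_mono mult_left_mono) auto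
      also have "\<dots> = e * (1 / real M ^ Suc n)"
        using R M(1) by (simp add: \<epsilon>_def)
      also have "\<dots> \<le> e * h" using n e by (intro mult_left_mono) auto
      finally show ?thesis by (simp add: h_def)
    qed simp
  qed
qed

text \<open>
  The signed chord slopes \<open>q n\<close> converge to the derivative \<open>D\<close>, while each step multiplies them
  by \<open>M * a > 1\<close> or \<open>- (M * b) < 0\<close>. So \<open>\<bar>q (Suc n) - q n\<bar>\<close>, which tends to 0, is at least a fixed
  multiple of \<open>\<bar>q n\<bar>\<close>.
\<close>
lemma F_differentiable_imp:
  assumes k: "expansion M x k" and D: "(F N a has_real_derivative D) (at x within {0..1})"
  shows "D = 0" and "(\<lambda>n. digit_prod M slope n (k n)) \<longlonglongrightarrow> 0"
proof -
  define q where "q n = real M ^ n * digit_prod M step n (k n)" for n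
  let ?u = "\<lambda>n. real (k n) / real M ^ n" and ?v = "\<lambda>n. (real (k n) + 1) / real M ^ n"
  have kn: "k n < M ^ n" and xk: "x \<in> cell M n (k n)" and ksuc: "k (Suc n) div M = k n" for n
    using k unfolding expansion_def by blast+
  have uv: "?v n - ?u n = (1 / real M) ^ n" for n
    by (simp add: diff_divide_distrib[symmetric] power_one_over)
  have "(\<lambda>n. (F N a (?v n) - F N a (?u n)) / (?v n - ?u n)) \<longlonglongrightarrow> D"
  proof (rule straddling_difference_quotients[OF D])
    fix n
    have "?u n \<in> cell M n (k n)" "?v n \<in> cell M n (k n)" using M by (auto simp: in_cell_iff)
    then show "?u n \<in> {0..1}" "?v n \<in> {0..1}" using cell_subset_unit[OF kn[of n]] by blast+
    show "?u n \<le> x" "x \<le> ?v n" using xk[of n] by (auto simp: cell_def)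
    show "?u n < ?v n" using M by (simp add: divide_strict_right_mono)
    show "(\<lambda>n. ?v n - ?u n) \<longlonglongrightarrow> 0"
      unfolding uv using M by (intro LIMSEQ_realpow_zero) auto
  qed
  moreover have "(F N a (?v n) - F N a (?u n)) / (?v n - ?u n) = q n" for n
    using F_cell[OF kn[of n], of 1] unfolding uv
    by (simp add: F_1 q_def power_one_over)
  ultimately have q: "q \<longlonglongrightarrow> D" by simp
  define \<delta> where "\<delta> = min 1 (real M * a - 1)"
  have \<delta>: "0 < \<delta>" using Ma_gt by (simp add: \<delta>_def)
  have jump: "\<delta> * \<bar>q n\<bar> \<le> \<bar>q (Suc n) - q n\<bar>" for n
  proof -
    define s where "s = real M * step (k (Suc n) mod M)"
    have "0 < real M * b" using b_bounds M by simp
    then have "\<delta> \<le> \<bar>s - 1\<bar>" unfolding \<delta>_def s_def step_def by auto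
    then have "\<delta> * \<bar>q n\<bar> \<le> \<bar>s - 1\<bar> * \<bar>q n\<bar>" by (intro mult_right_mono) auto
    also have "\<dots> = \<bar>(s - 1) * q n\<bar>" by (simp add: abs_mult)
    also have "(s - 1) * q n = q (Suc n) - q n"
      by (simp add: q_def s_def ksuc algebra_simps)
    finally show ?thesis .
  qed
  have "(\<lambda>n. \<delta> * \<bar>q n\<bar>) \<longlonglongrightarrow> \<delta> * \<bar>D\<bar>" by (intro tendsto_intros q)
  moreover have "(\<lambda>n. \<bar>q (Suc n) - q n\<bar>) \<longlonglongrightarrow> \<bar>D - D\<bar>"
    by (intro tendsto_intros q LIMSEQ_Suc)
  ultimately have "\<delta> * \<bar>D\<bar> \<le> \<bar>D - D\<bar>" by (rule LIMSEQ_le) (use jump in blast)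
  then show D0: "D = 0" using \<delta> by (simp add: mult_le_0_iff)
  have "(\<lambda>n. \<bar>q n\<bar>) \<longlonglongrightarrow> \<bar>D\<bar>" by (intro tendsto_intros q)
  then show "(\<lambda>n. digit_prod M slope n (k n)) \<longlonglongrightarrow> 0"
    by (simp add: D0 q_def digit_prod_slope abs_mult)
qed

lemma F_differentiable_iff:
  assumes "expansion M x k"
  shows "F N a differentiable (at x within {0..1}) \<longleftrightarrow> (\<lambda>n. digit_prod M slope n (k n)) \<longlonglongrightarrow> 0"
proof
  assume "F N a differentiable (at x within {0..1})"
  then obtain D where "(F N a has_real_derivative D) (at x within {0..1})"
    by (auto simp: real_differentiable_def)
  then show "(\<lambda>n. digit_prod M slope n (k n)) \<longlonglongrightarrow> 0" by (rule F_differentiable_imp(2)[OF assms])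
next
  assume "(\<lambda>n. digit_prod M slope n (k n)) \<longlonglongrightarrow> 0"
  then have "(F N a has_real_derivative 0) (at x within {0..1})" by (rule F_derivative_zero[OF assms])
  then show "F N a differentiable (at x within {0..1})" by (auto simp: real_differentiable_def)
qed

end

section \<open>The thresholds\<close>

lemma prod_periodic:
  fixes \<alpha> \<beta> :: real
  assumes m: "2 \<le> m"
  shows "(\<Prod>i<n. if m dvd i then \<alpha> else \<beta>) =
    (\<alpha> * \<beta> ^ (m - 1)) ^ (n div m) * (if n mod m = 0 then 1 else \<alpha> * \<beta> ^ (n mod m - 1))"
proof (induction n)
  case (Suc n)
  consider "n mod m = 0" | "n mod m \<noteq> 0" "Suc (n mod m) = m" | "n mod m \<noteq> 0" "Suc (n mod m) \<noteq> m"
    by blast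
  then show ?case
  proof cases
    case 1
    then have "Suc n mod m = 1" "Suc n div m = n div m" "m dvd n"
      using m by (auto simp: mod_Suc div_Suc)
    then show ?thesis using Suc 1 by simp
  next
    case 2
    then have r: "Suc n mod m = 0" "Suc n div m = Suc (n div m)" "\<not> m dvd n"
      by (auto simp: mod_Suc div_Suc dvd_eq_mod_eq_0)
    have "\<beta> ^ (n mod m - 1) * \<beta> = \<beta> ^ (m - 1)"
      using 2 power_Suc2[of \<beta> "n mod m - 1"] by (cases "n mod m") auto
    then show ?thesis using Suc 2 r by (simp add: mult.assoc)
  next
    case 3
    then have r: "Suc n mod m = Suc (n mod m)" "Suc n div m = n div m" "\<not> m dvd n"
      by (auto simp: mod_Suc div_Suc dvd_eq_mod_eq_0)
    have "\<beta> ^ (n mod m - 1) * \<beta> = \<beta> ^ (n mod m)"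
      using 3 power_Suc2[of \<beta> "n mod m - 1"] by (cases "n mod m") auto
    then show ?thesis using Suc 3 r by (simp add: mult.assoc)
  qed
qed simp

lemma prod_periodic_tendsto_zero:
  fixes \<alpha> \<beta> :: real
  assumes m: "2 \<le> m" and \<alpha>: "0 < \<alpha>" and \<beta>: "0 < \<beta>" "\<beta> < 1" and lt: "\<alpha> * \<beta> ^ (m - 1) < 1"
  shows "(\<lambda>n. \<Prod>i<n. if m dvd i then \<alpha> else \<beta>) \<longlonglongrightarrow> 0"
proof -
  define \<gamma> where "\<gamma> = \<alpha> * \<beta> ^ (m - 1)"
  have \<gamma>: "0 < \<gamma>" "\<gamma> < 1" using assms by (auto simp: \<gamma>_def)
  have "filterlim (\<lambda>n. n div m) at_top sequentially"
    unfolding filterlim_at_top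
  proof
    fix Z
    show "\<forall>\<^sub>F n in sequentially. Z \<le> n div m"
      using eventually_ge_at_top[of "Z * m"]
    proof (rule eventually_mono)
      fix n assume "Z * m \<le> n"
      then show "Z \<le> n div m" using m div_le_mono[of "Z * m" n m] by simp
    qed
  qed
  then have "(\<lambda>n. \<gamma> ^ (n div m)) \<longlonglongrightarrow> 0"
    using \<gamma> by (intro filterlim_compose[OF LIMSEQ_realpow_zero]) auto
  then have lim: "(\<lambda>n. \<gamma> ^ (n div m) * max 1 \<alpha>) \<longlonglongrightarrow> 0" by (rule tendsto_mult_left_zero)
  have upper: "(\<Prod>i<n. if m dvd i then \<alpha> else \<beta>) \<le> \<gamma> ^ (n div m) * max 1 \<alpha>" for n
  proof -
    have "\<alpha> * \<beta> ^ (n mod m - 1) \<le> \<alpha> * 1"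
      using \<alpha> \<beta> by (intro mult_left_mono power_le_one) auto
    then show ?thesis unfolding prod_periodic[OF m] \<gamma>_def[symmetric]
      using \<gamma> by (intro mult_left_mono) auto
  qed
  have lower: "0 \<le> (\<Prod>i<n. if m dvd i then \<alpha> else \<beta>)" for n
    using \<alpha> \<beta> by (intro prod_nonneg) auto
  show ?thesis
    by (rule tendsto_sandwich[OF _ _ tendsto_const lim]) (use upper lower in auto)
qed

text \<open>
  The product of the slope factors of all the digits \<open>0, \<dots>, 2 * N\<close>. It is 1 at the threshold
  \<open>a0_tilde N\<close>: the equation defining the threshold is this condition multiplied by \<open>N ^ N\<close>.
\<close>
definition slope_factor_product :: "nat \<Rightarrow> real \<Rightarrow> real" where
  "slope_factor_product N a =
    ((2 * real N + 1) * a) ^ (N + 1) * ((2 * real N + 1) * b_par N a) ^ N"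

lemma slope_factor_product_less:
  assumes N: "0 < N" and s: "a_min N < s" "s < t"
  shows "slope_factor_product N s < slope_factor_product N t"
proof -
  have s0: "0 < s" using s a_min_pos[of N] by linarith
  have "(real N + 1) * s > 1" using s by (simp add: a_min_def field_simps)
  then have bs: "0 < b_par N s" using N by (simp add: b_par_def)
  have bst: "b_par N s < b_par N t"
    using N s unfolding b_par_def by (intro divide_strict_right_mono) auto
  show ?thesis unfolding slope_factor_product_def
    using s0 s bs bst N
    by (intro mult_strict_mono power_strict_mono mult_strict_left_mono) auto
qed

lemma slope_factor_product_a0_tilde:
  assumes N: "0 < N"
  shows "slope_factor_product N (a0_tilde N) = 1" "a_min N < a0_tilde N"
proof -
  let ?A = "a0_tilde N"
  have A: "a_min N < ?A" "(2 * real N + 1) ^ (2 * N + 1) * ?A ^ (N + 1) * ((real N + 1) * ?A - 1) ^ N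
      = real N ^ N"
    using theI'[OF a0_tilde_unique[OF N], folded a0_tilde_def] by blast+
  show "a_min N < ?A" by fact
  have "(real N + 1) * ?A - 1 = real N * b_par N ?A" using N by (simp add: b_par_def)
  moreover have "(2 * real N + 1) ^ (2 * N + 1) = (2 * real N + 1) ^ (N + 1) * (2 * real N + 1) ^ N"
  proof -
    have "2 * N + 1 = (N + 1) + N" by simp
    then show ?thesis by (simp only: power_add)
  qed
  ultimately have "real N ^ N * slope_factor_product N ?A = real N ^ N"
    using A(2) by (simp only: slope_factor_product_def power_mult_distrib) (simp add: mult_ac)
  then show "slope_factor_product N ?A = 1" using N by simp
qed

context self_affine_family
begin

lemma slope_odd_ge_one_iff: "1 \<le> real M * b \<longleftrightarrow> a0_star N \<le> a"
proof -
  have "1 \<le> real M * b \<longleftrightarrow> real N \<le> real M * ((real N + 1) * a - 1)"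
    using N_pos by (simp add: b_par_def field_simps)
  also have "\<dots> \<longleftrightarrow> 3 * real N + 1 \<le> a * ((real N + 1) * (2 * real N + 1))"
    by (simp add: M algebra_simps)
  also have "\<dots> \<longleftrightarrow> a0_star N \<le> a"
    unfolding a0_star_def by (subst pos_divide_le_eq) auto
  finally show ?thesis .
qed

lemma sum_ln_slope: "(\<Sum>i<M. ln (slope i)) = ln (slope_factor_product N a)"
proof -
  have "(\<Sum>i<2 * n + 1. if even i then p else q) = (real n + 1) * p + real n * q" for n :: nat and p q :: real
    by (induction n) (auto simp: algebra_simps)
  from this[where n = N and p = "ln (real M * a)" and q = "ln (real M * b)"]
  have "(\<Sum>i<M. ln (slope i)) = (real N + 1) * ln (real M * a) + real N * ln (real M * b)"
    by (simp add: slope_eq M_def if_distrib[of ln] cong: if_cong)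
  also have "\<dots> = ln ((real M * a) ^ (N + 1) * (real M * b) ^ N)"
    using a_pos b_bounds M(1) by (subst ln_mult) (simp_all add: ln_realpow del: power_Suc)
  finally show ?thesis by (simp only: slope_factor_product_def M(3))
qed

lemma slope_factor_product_pos: "0 < slope_factor_product N a"
  unfolding slope_factor_product_def using a_pos b_bounds(1) M(1)
  by (intro mult_pos_pos zero_less_power) (simp_all flip: M(3))

lemma sum_ln_slope_neg_iff: "(\<Sum>i<M. ln (slope i)) < 0 \<longleftrightarrow> a < a0_tilde N"
proof -
  note A = slope_factor_product_a0_tilde[OF N_pos]
  have "slope_factor_product N a < 1 \<longleftrightarrow> a < a0_tilde N"
    using slope_factor_product_less[OF N_pos, of a "a0_tilde N"] a_gt A
      slope_factor_product_less[OF N_pos, of "a0_tilde N" a]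
    by (cases a "a0_tilde N" rule: linorder_cases) auto
  then show ?thesis using slope_factor_product_pos by (simp add: sum_ln_slope)
qed

lemma AE_unit_interval:
  assumes "AE x in lebesgue. \<forall>k. expansion M x k \<longrightarrow> Q x"
  shows "AE x in lebesgue_on {0..1}. Q x"
proof -
  have "AE x in lebesgue. x \<in> {0..1} \<longrightarrow> Q x"
    using assms by (rule AE_mp) (use expansion_exists[OF M(1)] in \<open>auto intro!: AE_I2\<close>)
  then show ?thesis by (simp add: AE_restrict_space_iff)
qed

lemma nowhere_differentiable:
  assumes "a0_star N \<le> a" and x: "x \<in> {0..1}"
  shows "\<not> F N a differentiable (at x within {0..1})"
proof
  assume diff: "F N a differentiable (at x within {0..1})"
  obtain k where k: "expansion M x k" using expansion_exists[OF M(1) x] by blast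
  have ge: "1 \<le> slope i" for i using slope_odd_ge_one_iff assms Ma_gt by (simp add: slope_eq)
  have "1 \<le> digit_prod M slope n j" for n j
  proof (induction n arbitrary: j)
    case (Suc n)
    show ?case using mult_mono[OF Suc[of "j div M"] ge[of "j mod M"]]
      slope_prod_pos[of n "j div M"] by simp
  qed simp
  moreover have "(\<lambda>n. digit_prod M slope n (k n)) \<longlonglongrightarrow> 0"
    using diff F_differentiable_iff[OF k] by blast
  ultimately have "(1::real) \<le> 0" by (intro LIMSEQ_le_const) auto
  then show False by simp
qed

lemma AE_nondifferentiable:
  assumes "a0_tilde N \<le> a"
  shows "AE x in lebesgue_on {0..1}. \<not> F N a differentiable (at x within {0..1})"
proof (rule AE_unit_interval)
  have "0 \<le> (\<Sum>i<M. ln (slope i))" using assms sum_ln_slope_neg_iff by linarith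
  from AE_not_digit_prod_tendsto_zero[of M slope, OF M(1) slope_pos this]
  show "AE x in lebesgue. \<forall>k. expansion M x k \<longrightarrow> \<not> F N a differentiable (at x within {0..1})"
    by (rule AE_mp) (auto intro!: AE_I2 simp: F_differentiable_iff)
qed

lemma AE_differentiable:
  assumes "a < a0_tilde N"
  shows "AE x in lebesgue_on {0..1}. F N a differentiable (at x within {0..1})"
proof (rule AE_unit_interval)
  have "(\<Sum>i<M. ln (slope i)) < 0" using assms sum_ln_slope_neg_iff by simp
  from AE_digit_prod_tendsto_zero[of M slope, OF M(1) slope_pos this]
  show "AE x in lebesgue. \<forall>k. expansion M x k \<longrightarrow> F N a differentiable (at x within {0..1})"
    by (rule AE_mp) (auto intro!: AE_I2 simp: F_differentiable_iff)
qed

lemma address_digits: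
  assumes d: "\<And>n. if m dvd n then d n \<in> {0, 2} else d n = (1::nat)"
  shows "digit_prod M slope n (address M d n) = (\<Prod>i<n. if m dvd i then real M * a else real M * b)"
proof -
  have "d n < M" for n using d[of n] M(2) by (auto split: if_splits)
  then have "digit_prod M slope n (address M d n) = (\<Prod>i<n. slope (d i))"
    by (rule digit_prod_address)
  also have "\<dots> = (\<Prod>i<n. if m dvd i then real M * a else real M * b)"
  proof (rule prod.cong[OF refl])
    fix i
    show "slope (d i) = (if m dvd i then real M * a else real M * b)"
      using d[of i] by (auto simp: slope_eq split: if_splits)
  qed
  finally show ?thesis .
qed

lemma expansion_unit:
  assumes "expansion M x k"
  shows "x \<in> {0..1}"
  using assms cell_subset_unit[of "k 0" 0] unfolding expansion_def by blast

text \<open>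
  Since \<open>M * b < 1\<close>, sufficiently many digits 1 after each free digit outweigh its factor \<open>M * a\<close>.
\<close>
lemma uncountable_differentiable:
  assumes "a < a0_star N"
  shows "uncountable {x \<in> {0..1}. F N a differentiable (at x within {0..1})}"
proof -
  have b1: "0 < real M * b" "real M * b < 1"
    using assms slope_odd_ge_one_iff b_bounds M by auto
  obtain j where j: "(real M * b) ^ j < 1 / (real M * a)"
    using real_arch_pow_inv[of "1 / (real M * a)" "real M * b"] b1 Ma_gt by auto
  have "j \<noteq> 0" using j Ma_gt by (cases j) auto
  have lt: "real M * a * (real M * b) ^ (Suc j - 1) < 1" using j Ma_gt by (simp add: field_simps)
  show ?thesis
  proof (rule uncountable_digit_choices[OF M(2), of "Suc j"])
    fix d x
    assume d: "\<And>n. if Suc j dvd n then d n \<in> {0, 2} else d n = 1"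
      and x: "expansion M x (address M d)"
    have "(\<lambda>n. digit_prod M slope n (address M d n)) \<longlonglongrightarrow> 0"
      unfolding address_digits[OF d]
      using \<open>j \<noteq> 0\<close> Ma_gt b1 lt by (intro prod_periodic_tendsto_zero) auto
    then show "x \<in> {x \<in> {0..1}. F N a differentiable (at x within {0..1})}"
      using F_differentiable_iff[OF x] expansion_unit[OF x] by simp
  qed simp
qed

text \<open>
  All digits may be chosen freely from \<open>{0, 2}\<close>, since the products then are \<open>(M * a) ^ n\<close>.
\<close>
lemma uncountable_nondifferentiable:
  "uncountable {x \<in> {0..1}. \<not> F N a differentiable (at x within {0..1})}"
proof (rule uncountable_digit_choices[OF M(2), of 1])
  fix d x
  assume d: "\<And>n. if 1 dvd n then d n \<in> {0, 2} else d n = (1::nat)"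
    and x: "expansion M x (address M d)"
  have "digit_prod M slope n (address M d n) = (real M * a) ^ n" for n
    using address_digits[OF d] by simp
  then have "1 \<le> digit_prod M slope n (address M d n)" for n using Ma_gt by simp
  then have "\<not> (\<lambda>n. digit_prod M slope n (address M d n)) \<longlonglongrightarrow> 0"
    using LIMSEQ_le_const[of "\<lambda>n. digit_prod M slope n (address M d n)" 0 1] by auto
  then show "x \<in> {x \<in> {0..1}. \<not> F N a differentiable (at x within {0..1})}"
    using F_differentiable_iff[OF x] expansion_unit[OF x] by simp
qed simp

lemma deriv_eq_zero:
  assumes x: "x \<in> {0<..<1}" and diff: "F N a differentiable (at x)"
  shows "deriv (F N a) x = 0"
proof -
  obtain k where k: "expansion M x k" using expansion_exists[OF M(1), of x] x by auto
  obtain D where D: "(F N a has_real_derivative D) (at x)"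
    using diff unfolding real_differentiable_def by blast
  then have "(F N a has_real_derivative D) (at x within {0..1})" by (rule has_field_derivative_at_within)
  then have "D = 0" by (rule F_differentiable_imp(1)[OF k])
  then show ?thesis using D DERIV_imp_deriv by blast
qed

end

theorem theorem2p1:
  fixes N :: nat and a :: real
  assumes "N > 0" and "a_min N < a" and "a < 1"
  shows "(a0_star N \<le> a \<longrightarrow>
            (\<forall>x\<in>{0..1}. \<not> F N a differentiable (at x within {0..1})))
       \<and> (a0_tilde N \<le> a \<and> a < a0_star N \<longrightarrow>
            (AE x in lebesgue_on {0..1}. \<not> F N a differentiable (at x within {0..1})) \<and>
            uncountable {x \<in> {0..1}. F N a differentiable (at x within {0..1})})
       \<and> (a < a0_tilde N \<longrightarrow>
            (AE x in lebesgue_on {0..1}. F N a differentiable (at x within {0..1})) \<and>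
            uncountable {x \<in> {0..1}. \<not> F N a differentiable (at x within {0..1})})
       \<and> (\<forall>x\<in>{0<..<1}. F N a differentiable (at x) \<longrightarrow> deriv (F N a) x = 0)"
proof -
  interpret self_affine_family N a using assms by unfold_locales
  show ?thesis
    by (intro conjI impI ballI; (elim conjE)?;
      rule nowhere_differentiable AE_nondifferentiable uncountable_differentiable
        AE_differentiable uncountable_nondifferentiable deriv_eq_zero; assumption)
qed

end
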